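(* Let $b(t)=\sum_{n=-r}^{s} b_n t^n$ be a Laurent polynomial with $r,s$ positive integers and $b_{-r}\neq 0$, $b_s\neq 0$. Let $0<\rho_l\le\rho_h<\infty$ be such that $\Lambda(b)=\bigcap_{\rho\in[\rho_l,\rho_h]}\operatorname{sp} T(b_\rho)$. Then $$\lim_{\Delta\to 0}\ \sup_{\boldsymbol{\rho}\in\mathcal{P}(\Delta)} d_H\Biggl(\bigcap_{j=0}^{n}\operatorname{sp} T(b_{\rho_j}),\ \Lambda(b)\Biggr)=0,$$ where $\boldsymbol{\rho}=(\rho_j)_{j=0}^{n}$ and $\mathcal{P}(\Delta)=\mathcal{P}_{[\rho_l,\rho_h]}(\Delta)$.
   Context: $\mathbb{T}$ is the unit circle in $\mathbb{C}$. For a continuous function (symbol) $a:\mathbb{T}\to\mathbb{C}$ with Fourier coefficients $(a_k)_{k\in\mathbb{Z}}$, $T(a)=(a_{j-k})_{j,k=0}^{\infty}$ is the Toeplitz operator on $\ell^2(\mathbb{N})$, a bounded operator, and $\operatorname{sp} T(a)$ is its spectrum. It is known (Gohberg) that $\operatorname{sp} T(a)=a(\mathbb{T})\cup\{\lambda\in\mathbb{C}\setminus a(\mathbb{T}):\operatorname{wind}(a-\lambda)\ne 0\}$, where $\operatorname{wind}(a-\lambda)$ is the winding number of the closed curve $v\mapsto a(e^{iv})$, $v\in[0,2\pi]$, around $\lambda$. For $\rho>0$, $b_\rho(t):=b(\rho t)$, $t\in\mathbb{T}$. The limit set: for $\lambda\in\mathbb{C}$ let $z_1(\lambda),\dots,z_{r+s}(\lambda)$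 be the zeros, with multiplicity, of $z\mapsto z^r(b(z)-\lambda)$, ordered so that $|z_j(\lambda)|\le|z_{j+1}(\lambda)|$. Then $\Lambda(b):=\{\lambda\in\mathbb{C}: |z_r(\lambda)|=|z_{r+1}(\lambda)|\}$. It is a known theorem of Schmidt and Spitzer that $\Lambda(b)=\bigcap_{\rho\in(0,\infty)}\operatorname{sp} T(b_\rho)$. A partition of $[\alpha,\beta]$ is a finite sequence $\alpha=x_0<x_1<\dots<x_n=\beta$ (with $n$ arbitrary); its granularity is $\max_{0\le j\le n-1}(x_{j+1}-x_j)$. (If $\alpha=\beta$ the only partition is the single point $x_0=\alpha$, with granularity $0$.) $\mathcal{P}_{[\alpha,\beta]}(\Delta)$ is the set of all partitions of $[\alpha,\beta]$ with granularity $\le\Delta$. $d_H$ is the Hausdorff metric on the set $\mathcal{C}$ of non-empty closed bounded subsets of $\mathbb{C}$: $d_H(A,B):=\inf\{\epsilon: A\subset(B)_\epsilon,\ B\subset(A)_\epsilon\}$, where $(X)_\epsilon:=\bigcup_{x\in X}\{z\in\mathbb{C}:|z-x|\le\epsilon\}$. *)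

theory Defs
  imports "HOL-Analysis.Analysis" "HOL-Computational_Algebra.Computational_Algebra"
begin

section \<open>Operators on the Hilbert space of square-summable sequences\<close>

text \<open>
  Vectors are plain sequences and operators are functions between sequences; only their
  behaviour on \<open>ell2\<close> is ever referred to.
\<close>

definition ell2 :: "(nat \<Rightarrow> complex) set" where
  "ell2 = {x. summable (\<lambda>n. (cmod (x n))\<^sup>2)}"

definition ell2_norm :: "(nat \<Rightarrow> complex) \<Rightarrow> real" where
  "ell2_norm x = sqrt (\<Sum>n. (cmod (x n))\<^sup>2)"

definition ell2_bounded_op :: "((nat \<Rightarrow> complex) \<Rightarrow> (nat \<Rightarrow> complex)) \<Rightarrow> bool" where
  "ell2_bounded_op A \<longleftrightarrow>
     (\<forall>x\<in>ell2. A x \<in> ell2) \<and>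
     (\<forall>x\<in>ell2. \<forall>y\<in>ell2. A (\<lambda>n. x n + y n) = (\<lambda>n. A x n + A y n)) \<and>
     (\<forall>c. \<forall>x\<in>ell2. A (\<lambda>n. c * x n) = (\<lambda>n. c * A x n)) \<and>
     (\<exists>C. \<forall>x\<in>ell2. ell2_norm (A x) \<le> C * ell2_norm x)"

text \<open>
  \<open>\<mu>\<close> lies in the spectrum iff \<open>A - \<mu> I\<close> has no two-sided inverse among the bounded operators.
\<close>

definition ell2_spectrum :: "((nat \<Rightarrow> complex) \<Rightarrow> (nat \<Rightarrow> complex)) \<Rightarrow> complex set" where
  "ell2_spectrum A = {\<mu>. \<not> (\<exists>S. ell2_bounded_op S \<and>
     (\<forall>x\<in>ell2. S (\<lambda>n. A x n - \<mu> * x n) = x \<and> (\<lambda>n. A (S x) n - \<mu> * S x n) = x))}"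


section \<open>Toeplitz operators\<close>

definition fourier_coeff :: "(complex \<Rightarrow> complex) \<Rightarrow> int \<Rightarrow> complex" where
  "fourier_coeff a k =
     complex_of_real (1 / (2 * pi)) *
       integral {0..2 * pi} (\<lambda>v. a (cis v) * cis (- (of_int k * v)))"

definition toeplitz :: "(complex \<Rightarrow> complex) \<Rightarrow> (nat \<Rightarrow> complex) \<Rightarrow> (nat \<Rightarrow> complex)" where
  "toeplitz a x = (\<lambda>j. \<Sum>k. fourier_coeff a (int j - int k) * x k)"


section \<open>Laurent polynomials and their limit set\<close>

definition laurent :: "nat \<Rightarrow> nat \<Rightarrow> (int \<Rightarrow> complex) \<Rightarrow> complex \<Rightarrow> complex" where
  "laurent r s b t = (\<Sum>n\<in>{- int r..int s}. b n * t powi n)"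

definition scaled_symbol :: "(complex \<Rightarrow> complex) \<Rightarrow> real \<Rightarrow> complex \<Rightarrow> complex" where
  "scaled_symbol a \<rho> t = a (of_real \<rho> * t)"

text \<open>The polynomial \<open>z\<^sup>r (b(z) - \<mu>)\<close>; see the lemma below.\<close>

definition shifted_poly :: "nat \<Rightarrow> nat \<Rightarrow> (int \<Rightarrow> complex) \<Rightarrow> complex \<Rightarrow> complex poly" where
  "shifted_poly r s b \<mu> =
     (\<Sum>n\<in>{- int r..int s}. monom (b n) (nat (n + int r))) - monom \<mu> r"

lemma poly_shifted_poly:
  assumes "z \<noteq> 0"
  shows "poly (shifted_poly r s b \<mu>) z = z ^ r * (laurent r s b z - \<mu>)"
proof -
  have *: "z ^ nat (n + int r) = z ^ r * z powi n" if "n \<in> {- int r..int s}" for n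
  proof -
    have "z ^ nat (n + int r) = z powi (n + int r)"
      using that by (simp add: power_int_def)
    also have "\<dots> = z ^ r * z powi n"
      using assms by (simp add: power_int_add)
    finally show ?thesis .
  qed
  have "poly (shifted_poly r s b \<mu>) z =
          (\<Sum>n\<in>{- int r..int s}. b n * z ^ nat (n + int r)) - \<mu> * z ^ r"
    by (simp add: shifted_poly_def poly_sum poly_monom)
  also have "(\<Sum>n\<in>{- int r..int s}. b n * z ^ nat (n + int r)) = z ^ r * laurent r s b z"
    unfolding laurent_def sum_distrib_left by (intro sum.cong refl) (simp add: *)
  finally show ?thesis
    by (simp add: algebra_simps)
qed

text \<open>
  \<open>zs ! (j - 1)\<close> is the zero written \<open>z\<^sub>j(\<mu>)\<close> on paper: list positions start at \<open>0\<close>.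
  The moduli, hence the set, do not depend on how zeros of equal modulus are ordered.
\<close>

definition limit_set :: "nat \<Rightarrow> nat \<Rightarrow> (int \<Rightarrow> complex) \<Rightarrow> complex set" where
  "limit_set r s b = {\<mu>. \<exists>zs.
     mset zs = proots (shifted_poly r s b \<mu>) \<and>
     sorted (map cmod zs) \<and>
     cmod (zs ! (r - 1)) = cmod (zs ! r)}"


section \<open>Partitions and the Hausdorff distance\<close>

text \<open>The inserted \<open>0\<close> only matters for one-point partitions, whose granularity is \<open>0\<close>.\<close>

definition granularity :: "real list \<Rightarrow> real" where
  "granularity xs = Max (insert 0 {xs ! Suc j - xs ! j | j. Suc j < length xs})"

definition partitions :: "real \<Rightarrow> real \<Rightarrow> real \<Rightarrow> real list set" where
  "partitions \<alpha> \<beta> \<Delta> = {xs. xs \<noteq> [] \<and> hd xs = \<alpha> \<and> last xs = \<beta> \<and>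
     sorted_wrt (<) xs \<and> granularity xs \<le> \<Delta>}"

definition closed_nbhd :: "real \<Rightarrow> complex set \<Rightarrow> complex set" where
  "closed_nbhd \<epsilon> X = (\<Union>x\<in>X. cball x \<epsilon>)"

text \<open>
  On non-empty bounded closed sets this is the usual real-valued Hausdorff metric. Extended
  real values avoid an arbitrary value for the infimum of the empty set: the distance is
  \<open>\<infinity>\<close> if no \<open>\<epsilon>\<close> is admissible.
\<close>

definition hausdorff_dist :: "complex set \<Rightarrow> complex set \<Rightarrow> ereal" where
  "hausdorff_dist A B =
     Inf (ereal ` {\<epsilon>. 0 \<le> \<epsilon> \<and> A \<subseteq> closed_nbhd \<epsilon> B \<and> B \<subseteq> closed_nbhd \<epsilon> A})"

end

theory Submission
  imports Defs
begin

text \<open>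
  The proof is a compactness argument. Write \<open>T \<rho>\<close> for the Toeplitz operator of the scaled symbol.
  A partition only contains points of the interval, so the finite intersection of spectra always
  contains the limit set, and the question is how far it can stick out. It is a bounded set, since
  the left end point belongs to every partition and the spectrum of a bounded operator is bounded.
  So a point that violates the estimate for a given \<open>\<epsilon>\<close> lies in a fixed compact set \<open>K\<close>, a large
  disc from which the open \<open>\<epsilon>\<close>-neighbourhood of the limit set has been removed.

  By hypothesis every \<open>\<mu>\<close> in \<open>K\<close> is outside the spectrum of \<open>T \<rho>\<close> for some \<open>\<rho>\<close> of the interval. This is
  an open condition on the pair \<open>(\<mu>, \<rho>)\<close> (\<open>resolvent_toeplitz_open\<close>), so compactness of \<open>K\<close> yields one
  \<open>\<delta>\<close> such that every \<open>\<mu>\<close> in \<open>K\<close> is outside the spectra of all \<open>T \<rho>'\<close> with \<open>\<rho>'\<close> within \<open>\<delta>\<close> of a suitable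
  \<open>\<rho>\<close> (\<open>uniform_resolvent_radius\<close>). A partition with granularity below \<open>\<delta>\<close> has a point that close to
  \<open>\<rho>\<close> (\<open>partition_near_point\<close>), and that point excludes \<open>\<mu>\<close> from the finite intersection.

  Openness is a perturbation statement about bounded operators: an operator that is close in norm to
  an invertible one is invertible, by a Neumann series (\<open>inverse_op_perturbation\<close>). It applies because
  \<open>T \<rho>\<close> is a finite combination of shifts with coefficients \<open>b n * \<rho> powi n\<close>
  (\<open>toeplitz_scaled_laurent\<close>), which depends continuously on \<open>\<rho> > 0\<close> in operator norm.
\<close>

section \<open>The norm of square-summable sequences\<close>

text \<open>
  Membership and norm bounds can be tested on finitely many coordinates at a time. This reduces
  the norm axioms, and later completeness, to the finite-dimensional facts about \<open>L2_set\<close>.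
\<close>

lemma ell2_by_L2_set:
  assumes "\<And>m. L2_set (\<lambda>i. cmod (x i)) {..<m} \<le> C"
  shows "x \<in> ell2" and "ell2_norm x \<le> C"
proof -
  have C: "C \<ge> 0" using assms[of 0] by simp
  have le: "(\<Sum>i<m. (cmod (x i))\<^sup>2) \<le> C\<^sup>2" for m
    using assms[of m] C unfolding L2_set_def by (simp add: sqrt_le_D)
  have sm: "summable (\<lambda>i. (cmod (x i))\<^sup>2)"
    by (rule summableI_nonneg_bounded[OF _ le]) simp
  then show "x \<in> ell2" by (simp add: ell2_def)
  have "(\<Sum>i. (cmod (x i))\<^sup>2) \<le> C\<^sup>2"
    by (rule suminf_le_const[OF sm le])
  then show "ell2_norm x \<le> C"
    unfolding ell2_norm_def using C by (rule real_le_lsqrt[rotated])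
qed

lemma L2_set_le_ell2_norm:
  assumes "x \<in> ell2"
  shows "L2_set (\<lambda>i. cmod (x i)) {..<m} \<le> ell2_norm x"
  unfolding L2_set_def ell2_norm_def real_sqrt_le_iff
  using assms by (intro sum_le_suminf) (auto simp: ell2_def)

lemma norm_coordinate_le_ell2_norm:
  assumes "x \<in> ell2"
  shows "cmod (x i) \<le> ell2_norm x"
proof -
  have "cmod (x i) \<le> L2_set (\<lambda>i. cmod (x i)) {..<Suc i}"
    using member_le_L2_set[of "{..<Suc i}" i "\<lambda>i. cmod (x i)"] by simp
  then show ?thesis
    using L2_set_le_ell2_norm[OF assms, of "Suc i"] by simp
qed

lemma ell2_norm_nonneg: "x \<in> ell2 \<Longrightarrow> 0 \<le> ell2_norm x"
  using norm_coordinate_le_ell2_norm[of x 0] norm_ge_zero order_trans by blast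

lemma ell2_zero: "(\<lambda>i. 0) \<in> ell2" and ell2_norm_zero: "ell2_norm (\<lambda>i. 0) = 0"
  by (simp_all add: ell2_def ell2_norm_def)

lemma ell2_norm_eq_zeroD: "x \<in> ell2 \<Longrightarrow> ell2_norm x \<le> 0 \<Longrightarrow> x = (\<lambda>i. 0)"
  using norm_coordinate_le_ell2_norm[of x] by (intro ext) (metis norm_le_zero_iff order_trans)

lemma
  assumes "x \<in> ell2" "y \<in> ell2"
  shows ell2_add: "(\<lambda>i. x i + y i) \<in> ell2"
    and ell2_norm_triangle: "ell2_norm (\<lambda>i. x i + y i) \<le> ell2_norm x + ell2_norm y"
proof -
  have "L2_set (\<lambda>i. cmod (x i + y i)) {..<m} \<le> ell2_norm x + ell2_norm y" for m
  proof -
    have "L2_set (\<lambda>i. cmod (x i + y i)) {..<m} \<le> L2_set (\<lambda>i. cmod (x i) + cmod (y i)) {..<m}"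
      by (intro L2_set_mono norm_triangle_ineq) simp
    also have "\<dots> \<le> L2_set (\<lambda>i. cmod (x i)) {..<m} + L2_set (\<lambda>i. cmod (y i)) {..<m}"
      by (rule L2_set_triangle_ineq)
    finally show ?thesis
      using L2_set_le_ell2_norm[OF assms(1), of m] L2_set_le_ell2_norm[OF assms(2), of m] by simp
  qed
  note * = ell2_by_L2_set[where x = "\<lambda>i. x i + y i", OF this]
  show "(\<lambda>i. x i + y i) \<in> ell2" "ell2_norm (\<lambda>i. x i + y i) \<le> ell2_norm x + ell2_norm y"
    by (fact *)+
qed

lemma ell2_scale:
  assumes "x \<in> ell2"
  shows "(\<lambda>i. c * x i) \<in> ell2"
  using assms by (simp add: ell2_def norm_mult power_mult_distrib summable_mult)

lemma ell2_norm_scale: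
  assumes "x \<in> ell2"
  shows "ell2_norm (\<lambda>i. c * x i) = cmod c * ell2_norm x"
  using assms
  by (simp add: ell2_def ell2_norm_def norm_mult power_mult_distrib suminf_mult real_sqrt_mult)

lemma
  assumes "x \<in> ell2" "y \<in> ell2"
  shows ell2_diff: "(\<lambda>i. x i - y i) \<in> ell2"
    and ell2_norm_diff_le: "ell2_norm (\<lambda>i. x i - y i) \<le> ell2_norm x + ell2_norm y"
  using ell2_add[OF assms(1) ell2_scale[OF assms(2), of "-1"]]
    ell2_norm_triangle[OF assms(1) ell2_scale[OF assms(2), of "-1"]]
    ell2_norm_scale[OF assms(2), of "-1"]
  by simp_all

lemma
  assumes "finite F" "\<And>n. n \<in> F \<Longrightarrow> x n \<in> ell2"
  shows ell2_sum: "(\<lambda>i. \<Sum>n\<in>F. x n i) \<in> ell2"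
    and ell2_norm_sum: "ell2_norm (\<lambda>i. \<Sum>n\<in>F. x n i) \<le> (\<Sum>n\<in>F. ell2_norm (x n))"
proof -
  have "(\<lambda>i. \<Sum>n\<in>F. x n i) \<in> ell2 \<and>
      ell2_norm (\<lambda>i. \<Sum>n\<in>F. x n i) \<le> (\<Sum>n\<in>F. ell2_norm (x n))"
    using assms
  proof (induction F)
    case empty
    then show ?case by (simp add: ell2_zero ell2_norm_zero)
  next
    case (insert a F)
    then have IH: "(\<lambda>i. \<Sum>n\<in>F. x n i) \<in> ell2"
      "ell2_norm (\<lambda>i. \<Sum>n\<in>F. x n i) \<le> (\<Sum>n\<in>F. ell2_norm (x n))" "x a \<in> ell2"
      by auto
    show ?case
      using insert.hyps ell2_add[OF IH(3,1)] ell2_norm_triangle[OF IH(3,1)] IH(2) by simp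
  qed
  then show "(\<lambda>i. \<Sum>n\<in>F. x n i) \<in> ell2"
    "ell2_norm (\<lambda>i. \<Sum>n\<in>F. x n i) \<le> (\<Sum>n\<in>F. ell2_norm (x n))" by auto
qed

text \<open>
  This is the completeness of \<open>ell2\<close> in the form that the Neumann series needs: an absolutely
  convergent series of vectors may be summed coordinate by coordinate, and the norm bound survives
  because it can be tested on finitely many coordinates at a time.
\<close>

lemma
  assumes x: "\<And>n. x n \<in> ell2" and sm: "summable (\<lambda>n. ell2_norm (x n))"
  shows summable_ell2_coordinate: "summable (\<lambda>n. x n i)"
    and ell2_suminf: "(\<lambda>i. \<Sum>n. x n i) \<in> ell2"
    and ell2_norm_suminf: "ell2_norm (\<lambda>i. \<Sum>n. x n i) \<le> (\<Sum>n. ell2_norm (x n))"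
proof -
  have coord: "summable (\<lambda>n. x n i)" for i
    by (rule summable_comparison_test'[OF sm, of 0]) (simp add: norm_coordinate_le_ell2_norm x)
  show "summable (\<lambda>n. x n i)" by (rule coord)
  have "L2_set (\<lambda>i. cmod (\<Sum>n. x n i)) {..<m} \<le> (\<Sum>n. ell2_norm (x n))" for m
  proof (rule LIMSEQ_le_const2)
    show "(\<lambda>N. L2_set (\<lambda>i. cmod (\<Sum>n<N. x n i)) {..<m})
        \<longlonglongrightarrow> L2_set (\<lambda>i. cmod (\<Sum>n. x n i)) {..<m}"
      unfolding L2_set_def by (intro tendsto_intros summable_LIMSEQ coord)
    have "L2_set (\<lambda>i. cmod (\<Sum>n<N. x n i)) {..<m} \<le> (\<Sum>n. ell2_norm (x n))" for N
    proof -
      have "L2_set (\<lambda>i. cmod (\<Sum>n<N. x n i)) {..<m} \<le> ell2_norm (\<lambda>i. \<Sum>n<N. x n i)"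
        by (intro L2_set_le_ell2_norm ell2_sum x) simp
      also have "\<dots> \<le> (\<Sum>n<N. ell2_norm (x n))"
        by (intro ell2_norm_sum x) simp
      also have "\<dots> \<le> (\<Sum>n. ell2_norm (x n))"
        by (intro sum_le_suminf sm) (simp_all add: ell2_norm_nonneg x)
      finally show ?thesis .
    qed
    then show "\<exists>N. \<forall>n\<ge>N. L2_set (\<lambda>i. cmod (\<Sum>k<n. x k i)) {..<m} \<le> (\<Sum>n. ell2_norm (x n))"
      by blast
  qed
  note * = ell2_by_L2_set[where x = "\<lambda>i. \<Sum>n. x n i", OF this]
  show "(\<lambda>i. \<Sum>n. x n i) \<in> ell2" "ell2_norm (\<lambda>i. \<Sum>n. x n i) \<le> (\<Sum>n. ell2_norm (x n))"
    by (fact *)+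
qed

section \<open>Bounded operators and stability of invertibility\<close>

lemma
  assumes "ell2_bounded_op A" "x \<in> ell2"
  shows bounded_op_ell2: "A x \<in> ell2"
    and bounded_op_scale: "A (\<lambda>n. c * x n) = (\<lambda>n. c * A x n)"
  using assms unfolding ell2_bounded_op_def by blast+

lemma bounded_op_add:
  assumes "ell2_bounded_op A" "x \<in> ell2" "y \<in> ell2"
  shows "A (\<lambda>n. x n + y n) = (\<lambda>n. A x n + A y n)"
  using assms unfolding ell2_bounded_op_def by blast

lemma bounded_op_diff:
  assumes "ell2_bounded_op A" "x \<in> ell2" "y \<in> ell2"
  shows "A (\<lambda>n. x n - y n) = (\<lambda>n. A x n - A y n)"
  using bounded_op_add[OF assms(1,2) ell2_scale[OF assms(3), of "-1"]]
    bounded_op_scale[OF assms(1,3), of "-1"] by simp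

lemma bounded_op_bound:
  assumes "ell2_bounded_op A"
  obtains C where "C > 0" "\<And>x. x \<in> ell2 \<Longrightarrow> ell2_norm (A x) \<le> C * ell2_norm x"
proof -
  obtain C where C: "\<And>x. x \<in> ell2 \<Longrightarrow> ell2_norm (A x) \<le> C * ell2_norm x"
    using assms unfolding ell2_bounded_op_def by blast
  have "ell2_norm (A x) \<le> max C 1 * ell2_norm x" if "x \<in> ell2" for x
    using C[OF that] mult_right_mono[OF max.cobounded1 ell2_norm_nonneg[OF that], of C 1] by simp
  then show thesis using that[of "max C 1"] by simp
qed

lemma bounded_op_finite_sum:
  assumes "ell2_bounded_op A" "finite F" "\<And>n. n \<in> F \<Longrightarrow> x n \<in> ell2"
  shows "A (\<lambda>i. \<Sum>n\<in>F. x n i) = (\<lambda>i. \<Sum>n\<in>F. A (x n) i)"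
  using assms(2,3)
proof (induction F)
  case empty
  then show ?case using bounded_op_scale[OF assms(1) ell2_zero, of 0] by simp
next
  case (insert a F)
  then show ?case using bounded_op_add[OF assms(1), of "x a" "\<lambda>i. \<Sum>n\<in>F. x n i"]
    by (simp add: ell2_sum)
qed

text \<open>
  The operator commutes with partial sums, and the tail of the series has norm at most the tail of
  the convergent series of norms, so the error tends to \<open>0\<close> in every coordinate.
\<close>

lemma bounded_op_suminf:
  assumes A: "ell2_bounded_op A"
    and x: "\<And>n. x n \<in> ell2" and sm: "summable (\<lambda>n. ell2_norm (x n))"
  shows "A (\<lambda>i. \<Sum>n. x n i) = (\<lambda>i. \<Sum>n. A (x n) i)"
proof
  fix i
  let ?X = "\<lambda>i. \<Sum>n. x n i" and ?P = "\<lambda>N i. \<Sum>n<N. x n i"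
  obtain C where C: "C > 0" "\<And>x. x \<in> ell2 \<Longrightarrow> ell2_norm (A x) \<le> C * ell2_norm x"
    using bounded_op_bound[OF A] by blast
  have X: "?X \<in> ell2" by (rule ell2_suminf[OF x sm])
  have P: "?P N \<in> ell2" for N by (intro ell2_sum x) simp
  have le: "cmod ((\<Sum>n<N. A (x n) i) - A ?X i)
      \<le> C * ((\<Sum>n. ell2_norm (x n)) - (\<Sum>n<N. ell2_norm (x n)))" for N
  proof -
    have tail: "(\<lambda>i. ?X i - ?P N i) = (\<lambda>i. \<Sum>n. x (n + N) i)"
      by (rule ext) (simp add: suminf_split_initial_segment[OF summable_ell2_coordinate[OF x sm], of _ N])
    have "A (\<lambda>i. ?X i - ?P N i) i = A ?X i - (\<Sum>n<N. A (x n) i)"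
      by (simp add: bounded_op_diff[OF A X P] bounded_op_finite_sum[OF A _ x])
    then have "cmod ((\<Sum>n<N. A (x n) i) - A ?X i) = cmod (A (\<lambda>i. ?X i - ?P N i) i)"
      by (simp add: norm_minus_commute)
    also have "\<dots> \<le> ell2_norm (A (\<lambda>i. ?X i - ?P N i))"
      by (intro norm_coordinate_le_ell2_norm bounded_op_ell2[OF A] ell2_diff X P)
    also have "\<dots> \<le> C * ell2_norm (\<lambda>i. ?X i - ?P N i)"
      by (intro C ell2_diff X P)
    also have "ell2_norm (\<lambda>i. ?X i - ?P N i) \<le> (\<Sum>n. ell2_norm (x (n + N)))"
      unfolding tail by (intro ell2_norm_suminf x summable_ignore_initial_segment sm)
    finally show ?thesis
      using C(1) suminf_split_initial_segment[OF sm, of N] by simp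
  qed
  have "(\<lambda>N. C * ((\<Sum>n. ell2_norm (x n)) - (\<Sum>n<N. ell2_norm (x n)))) \<longlonglongrightarrow>
      C * ((\<Sum>n. ell2_norm (x n)) - (\<Sum>n. ell2_norm (x n)))"
    by (intro tendsto_mult tendsto_diff tendsto_const summable_LIMSEQ[OF sm])
  then have "(\<lambda>N. C * ((\<Sum>n. ell2_norm (x n)) - (\<Sum>n<N. ell2_norm (x n)))) \<longlonglongrightarrow> 0"
    by simp
  then have "(\<lambda>N. (\<Sum>n<N. A (x n) i) - A ?X i) \<longlonglongrightarrow> 0"
    by (rule Lim_null_comparison[rotated]) (intro always_eventually allI le)
  then have "(\<lambda>n. A (x n) i) sums A ?X i"
    unfolding sums_def by (rule LIM_zero_cancel)
  then show "A ?X i = (\<Sum>n. A (x n) i)" by (simp add: sums_iff)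
qed

text \<open>
  The solution of \<open>z - K z = y\<close> is the Neumann series: the sum of the iterates \<open>(K ^^ n) y\<close>, whose norms
  decay like \<open>q ^ n\<close>. Applying \<open>K\<close> to the sum drops its first term \<open>y\<close>.
\<close>

lemma neumann_solution:
  assumes K: "ell2_bounded_op K"
    and q: "\<And>x. x \<in> ell2 \<Longrightarrow> ell2_norm (K x) \<le> q * ell2_norm x" "0 \<le> q" "q < 1"
    and y: "y \<in> ell2"
  obtains z where "z \<in> ell2" "(\<lambda>i. z i - K z i) = y"
proof -
  define x where "x n = (K ^^ n) y" for n
  have x: "x n \<in> ell2" for n
    unfolding x_def by (induction n) (auto simp: y bounded_op_ell2[OF K])
  have nx: "ell2_norm (x n) \<le> ell2_norm y * q ^ n" for n
  proof (induction n)
    case (Suc n)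
    have "ell2_norm (x (Suc n)) \<le> q * ell2_norm (x n)"
      using q(1)[OF x] by (simp add: x_def)
    also have "\<dots> \<le> q * (ell2_norm y * q ^ n)"
      using Suc q(2) by (rule mult_left_mono)
    finally show ?case by (simp add: mult_ac)
  qed (simp add: x_def)
  have sm: "summable (\<lambda>n. ell2_norm (x n))"
    using q by (intro summable_comparison_test'[where N = 0 and g = "\<lambda>n. ell2_norm y * q ^ n", OF summable_mult[OF summable_geometric]])
      (auto simp: ell2_norm_nonneg x nx)
  define z where "z i = (\<Sum>n. x n i)" for i
  have "z \<in> ell2" unfolding z_def by (rule ell2_suminf[OF x sm])
  moreover have "z i - K z i = y i" for i
  proof -
    have "K z i = (\<Sum>n. x (Suc n) i)"
      using fun_cong[OF bounded_op_suminf[OF K x sm], of i] by (simp add: z_def[abs_def] x_def)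
    also have "\<dots> = z i - x 0 i"
      unfolding z_def by (rule suminf_split_head[OF summable_ell2_coordinate[OF x sm]])
    finally show ?thesis by (simp add: x_def)
  qed
  ultimately show thesis using that by blast
qed

definition ell2_inverse_op ::
    "((nat \<Rightarrow> complex) \<Rightarrow> nat \<Rightarrow> complex) \<Rightarrow> ((nat \<Rightarrow> complex) \<Rightarrow> nat \<Rightarrow> complex) \<Rightarrow> bool" where
  "ell2_inverse_op S B \<longleftrightarrow> ell2_bounded_op S \<and> (\<forall>x\<in>ell2. S (B x) = x \<and> B (S x) = x)"

lemma not_in_ell2_spectrum_iff:
  "\<mu> \<notin> ell2_spectrum A \<longleftrightarrow> (\<exists>S. ell2_inverse_op S (\<lambda>x n. A x n - \<mu> * x n))"
  by (simp add: ell2_spectrum_def ell2_inverse_op_def)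

text \<open>
  The lower bound makes \<open>B\<close> injective, hence the preimages depend linearly on \<open>y\<close>, and the same bound
  read backwards is boundedness of the inverse.
\<close>

lemma inverse_op_if_bounded_below:
  assumes B: "ell2_bounded_op B"
    and below: "\<And>x. x \<in> ell2 \<Longrightarrow> ell2_norm x \<le> C * ell2_norm (B x)"
    and surj: "\<And>y. y \<in> ell2 \<Longrightarrow> \<exists>x\<in>ell2. B x = y"
  shows "\<exists>S. ell2_inverse_op S B"
proof -
  have inj: "x = y" if "x \<in> ell2" "y \<in> ell2" "B x = B y" for x y
  proof -
    have "ell2_norm (\<lambda>n. x n - y n) \<le> 0"
      using below[OF ell2_diff[OF that(1,2)]] that(3)
      by (simp add: bounded_op_diff[OF B that(1,2)] ell2_norm_zero)
    then have "(\<lambda>n. x n - y n) = (\<lambda>n. 0)"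
      by (rule ell2_norm_eq_zeroD[OF ell2_diff[OF that(1,2)]])
    then show ?thesis by (simp add: fun_eq_iff)
  qed
  obtain S where S: "\<And>y. y \<in> ell2 \<Longrightarrow> S y \<in> ell2" "\<And>y. y \<in> ell2 \<Longrightarrow> B (S y) = y"
    using surj by metis
  have SB: "S (B x) = x" if "x \<in> ell2" for x
    using that by (intro inj[of "S (B x)" x] S bounded_op_ell2[OF B])
  have "S (\<lambda>n. x n + y n) = (\<lambda>n. S x n + S y n)" if "x \<in> ell2" "y \<in> ell2" for x y
    using that by (intro inj[of "S (\<lambda>n. x n + y n)"] S ell2_add)
      (simp_all add: S bounded_op_add[OF B] ell2_add)
  moreover have "S (\<lambda>n. c * x n) = (\<lambda>n. c * S x n)" if "x \<in> ell2" for c x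
    using that by (intro inj[of "S (\<lambda>n. c * x n)"] S ell2_scale)
      (simp_all add: S bounded_op_scale[OF B] ell2_scale)
  moreover have "ell2_norm (S x) \<le> C * ell2_norm x" if "x \<in> ell2" for x
    using below[OF S(1)[OF that]] by (simp add: S(2) that)
  ultimately have "ell2_bounded_op S"
    unfolding ell2_bounded_op_def using S(1) by blast
  then have "ell2_inverse_op S B"
    using SB S by (simp add: ell2_inverse_op_def)
  then show ?thesis by blast
qed

text \<open>
  With \<open>K = (B - B') S\<close>, which has norm at most \<open>C * d < 1\<close>, one has \<open>B' S = 1 - K\<close>. The Neumann
  series for \<open>K\<close> therefore gives surjectivity of \<open>B'\<close>. Injectivity does not follow from this one-sided
  factorisation; it comes from the lower bound for \<open>B\<close>, which a perturbation of norm \<open>d\<close> does not destroy.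
\<close>

lemma inverse_op_perturbation:
  assumes B: "ell2_bounded_op B" and B': "ell2_bounded_op B'" and S: "ell2_inverse_op S B"
    and C: "\<And>x. x \<in> ell2 \<Longrightarrow> ell2_norm (S x) \<le> C * ell2_norm x" "0 \<le> C"
    and d: "\<And>x. x \<in> ell2 \<Longrightarrow> ell2_norm (\<lambda>n. B x n - B' x n) \<le> d * ell2_norm x" "0 \<le> d"
    and Cd: "C * d < 1"
  shows "\<exists>S'. ell2_inverse_op S' B'"
proof -
  have Sb: "ell2_bounded_op S" and SB: "\<And>x. x \<in> ell2 \<Longrightarrow> S (B x) = x"
    and BS: "\<And>x. x \<in> ell2 \<Longrightarrow> B (S x) = x"
    using S by (auto simp: ell2_inverse_op_def)
  define K where "K x n = B (S x) n - B' (S x) n" for x n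
  have nK: "ell2_norm (K x) \<le> (C * d) * ell2_norm x" if "x \<in> ell2" for x
  proof -
    have "ell2_norm (K x) \<le> d * ell2_norm (S x)"
      unfolding K_def[abs_def] by (intro d bounded_op_ell2[OF Sb] that)
    also have "\<dots> \<le> d * (C * ell2_norm x)"
      by (intro mult_left_mono C d(2) that)
    finally show ?thesis by (simp add: mult_ac)
  qed
  have Kb: "ell2_bounded_op K"
    unfolding ell2_bounded_op_def
  proof (intro conjI ballI allI)
    fix x y assume xy: "x \<in> ell2" "y \<in> ell2"
    show "K (\<lambda>n. x n + y n) = (\<lambda>n. K x n + K y n)"
      using xy by (simp add: K_def[abs_def] bounded_op_add[OF Sb] bounded_op_add[OF B]
          bounded_op_add[OF B'] bounded_op_ell2[OF Sb] algebra_simps)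
  next
    fix c x assume x: "x \<in> ell2"
    show "K (\<lambda>n. c * x n) = (\<lambda>n. c * K x n)"
      using x by (simp add: K_def[abs_def] bounded_op_scale[OF Sb] bounded_op_scale[OF B]
          bounded_op_scale[OF B'] bounded_op_ell2[OF Sb] algebra_simps)
  next
    fix x assume "x \<in> ell2"
    then show "K x \<in> ell2"
      unfolding K_def[abs_def]
      by (intro ell2_diff bounded_op_ell2[OF B] bounded_op_ell2[OF B'] bounded_op_ell2[OF Sb])
  next
    show "\<exists>q. \<forall>x\<in>ell2. ell2_norm (K x) \<le> q * ell2_norm x"
      using nK by blast
  qed
  show ?thesis
  proof (rule inverse_op_if_bounded_below[OF B'])
    fix y :: "nat \<Rightarrow> complex" assume y: "y \<in> ell2"
    obtain z where z: "z \<in> ell2" "(\<lambda>i. z i - K z i) = y"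
      using neumann_solution[OF Kb nK _ Cd y] C(2) d(2) by auto
    have "B' (S z) = (\<lambda>i. z i - K z i)"
      using BS[OF z(1)] by (simp add: K_def)
    then show "\<exists>x\<in>ell2. B' x = y"
      using z bounded_op_ell2[OF Sb] by auto
  next
    fix x :: "nat \<Rightarrow> complex" assume x: "x \<in> ell2"
    have Bx: "B x \<in> ell2" and B'x: "B' x \<in> ell2"
      using x B B' bounded_op_ell2 by auto
    have "ell2_norm (B x) \<le> ell2_norm (\<lambda>n. B x n - B' x n) + ell2_norm (B' x)"
      using ell2_norm_triangle[OF ell2_diff[OF Bx B'x] B'x] by simp
    also have "\<dots> \<le> d * ell2_norm x + ell2_norm (B' x)"
      using d(1)[OF x] by simp
    finally have "C * ell2_norm (B x) \<le> C * (d * ell2_norm x + ell2_norm (B' x))"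
      using C(2) by (rule mult_left_mono)
    moreover have "ell2_norm x \<le> C * ell2_norm (B x)"
      using C(1)[OF Bx] SB[OF x] by simp
    ultimately have "(1 - C * d) * ell2_norm x \<le> C * ell2_norm (B' x)"
      by (simp add: algebra_simps)
    then show "ell2_norm x \<le> C / (1 - C * d) * ell2_norm (B' x)"
      using Cd by (simp add: field_simps)
  qed
qed

section \<open>Banded Toeplitz operators\<close>

text \<open>
  For \<open>n \<ge> 0\<close> this is the \<open>n\<close>-th power of the unilateral forward shift, and for \<open>n < 0\<close> the power
  \<open>-n\<close> of the backward shift, so the matrix of \<open>shift n\<close> is the \<open>n\<close>-th diagonal.
\<close>

definition shift :: "int \<Rightarrow> (nat \<Rightarrow> complex) \<Rightarrow> nat \<Rightarrow> complex" where
  "shift n x j = (if n \<le> int j then x (nat (int j - n)) else 0)"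

lemma
  assumes "x \<in> ell2"
  shows ell2_shift: "shift n x \<in> ell2" and ell2_norm_shift: "ell2_norm (shift n x) \<le> ell2_norm x"
proof -
  have "L2_set (\<lambda>j. cmod (shift n x j)) {..<m} \<le> ell2_norm x" for m
  proof -
    let ?I = "{j. j < m \<and> n \<le> int j}" and ?g = "\<lambda>j. nat (int j - n)"
    have "(\<Sum>j<m. (cmod (shift n x j))\<^sup>2) = (\<Sum>j\<in>?I. (cmod (x (?g j)))\<^sup>2)"
      by (rule sum.mono_neutral_cong_right) (auto simp: shift_def)
    also have "\<dots> = (\<Sum>k\<in>?g ` ?I. (cmod (x k))\<^sup>2)"
      by (subst sum.reindex) (auto simp: inj_on_def)
    also have "\<dots> \<le> (\<Sum>k. (cmod (x k))\<^sup>2)"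
      using assms by (intro sum_le_suminf) (auto simp: ell2_def)
    finally show ?thesis
      by (simp add: L2_set_def ell2_norm_def)
  qed
  note * = ell2_by_L2_set[where x = "shift n x", OF this]
  show "shift n x \<in> ell2" "ell2_norm (shift n x) \<le> ell2_norm x"
    by (fact *)+
qed

definition band_op :: "int set \<Rightarrow> (int \<Rightarrow> complex) \<Rightarrow> (nat \<Rightarrow> complex) \<Rightarrow> nat \<Rightarrow> complex" where
  "band_op F c x j = (\<Sum>n\<in>F. c n * shift n x j)"

lemma
  assumes "finite F" "x \<in> ell2"
  shows ell2_band_op: "band_op F c x \<in> ell2"
    and ell2_norm_band_op: "ell2_norm (band_op F c x) \<le> (\<Sum>n\<in>F. cmod (c n)) * ell2_norm x"
proof -
  have sh: "(\<lambda>j. c n * shift n x j) \<in> ell2" for n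
    by (intro ell2_scale ell2_shift assms)
  show "band_op F c x \<in> ell2"
    unfolding band_op_def[abs_def] by (intro ell2_sum assms sh)
  have "ell2_norm (band_op F c x) \<le> (\<Sum>n\<in>F. ell2_norm (\<lambda>j. c n * shift n x j))"
    unfolding band_op_def[abs_def] by (intro ell2_norm_sum assms sh)
  also have "\<dots> \<le> (\<Sum>n\<in>F. cmod (c n) * ell2_norm x)"
    by (intro sum_mono) (simp add: ell2_norm_scale ell2_shift assms mult_left_mono ell2_norm_shift)
  finally show "ell2_norm (band_op F c x) \<le> (\<Sum>n\<in>F. cmod (c n)) * ell2_norm x"
    by (simp add: sum_distrib_right)
qed

lemma bounded_op_band_op_minus_scalar:
  assumes F: "finite F"
  shows "ell2_bounded_op (\<lambda>x n. band_op F c x n - \<mu> * x n)"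
  unfolding ell2_bounded_op_def
proof (intro conjI ballI allI)
  fix x :: "nat \<Rightarrow> complex" assume x: "x \<in> ell2"
  show "(\<lambda>n. band_op F c x n - \<mu> * x n) \<in> ell2"
    by (intro ell2_diff ell2_band_op ell2_scale F x)
next
  fix x y :: "nat \<Rightarrow> complex"
  have "shift n (\<lambda>n. x n + y n) j = shift n x j + shift n y j" for n j
    by (simp add: shift_def)
  then show "(\<lambda>n. band_op F c (\<lambda>n. x n + y n) n - \<mu> * (x n + y n)) =
      (\<lambda>n. band_op F c x n - \<mu> * x n + (band_op F c y n - \<mu> * y n))"
    by (simp add: band_op_def fun_eq_iff ring_distribs sum.distrib)
next
  fix a and x :: "nat \<Rightarrow> complex"
  have "shift n (\<lambda>n. a * x n) j = a * shift n x j" for n j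
    by (simp add: shift_def)
  then show "(\<lambda>n. band_op F c (\<lambda>n. a * x n) n - \<mu> * (a * x n)) =
      (\<lambda>n. a * (band_op F c x n - \<mu> * x n))"
    by (simp add: band_op_def fun_eq_iff right_diff_distrib sum_distrib_left mult_ac)
next
  have "ell2_norm (\<lambda>n. band_op F c x n - \<mu> * x n)
      \<le> ((\<Sum>n\<in>F. cmod (c n)) + cmod \<mu>) * ell2_norm x" if "x \<in> ell2" for x
    using ell2_norm_diff_le[OF ell2_band_op[OF F that, of c] ell2_scale[OF that, of \<mu>]]
      ell2_norm_band_op[OF F that, of c] by (simp add: ell2_norm_scale that distrib_right)
  then show "\<exists>C. \<forall>x\<in>ell2. ell2_norm (\<lambda>n. band_op F c x n - \<mu> * x n) \<le> C * ell2_norm x"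
    by blast
qed

lemma band_op_diff: "band_op F c x j - band_op F c' x j = band_op F (\<lambda>n. c n - c' n) x j"
  by (simp add: band_op_def sum_subtractf left_diff_distrib)

text \<open>
  For larger \<open>\<mu>\<close> the operator is a small perturbation of the invertible scalar \<open>-\<mu>\<close>, which appears here
  as the band operator with zero coefficients minus \<open>\<mu>\<close>.
\<close>

lemma spectrum_band_op_bounded:
  assumes F: "finite F" and \<mu>: "\<mu> \<in> ell2_spectrum (band_op F c)"
  shows "cmod \<mu> \<le> (\<Sum>n\<in>F. cmod (c n))"
proof (rule ccontr)
  assume "\<not> ?thesis"
  then have gt: "(\<Sum>n\<in>F. cmod (c n)) < cmod \<mu>" by simp
  then have [simp]: "\<mu> \<noteq> 0"
    using sum_nonneg[of F "\<lambda>n. cmod (c n)"] by auto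
  let ?S = "\<lambda>x n. (- 1 / \<mu>) * x n :: complex"
  have nS: "ell2_norm (?S x) \<le> 1 / cmod \<mu> * ell2_norm x" if "x \<in> ell2" for x
    unfolding ell2_norm_scale[OF that] by (simp add: norm_divide)
  have "ell2_bounded_op ?S"
    unfolding ell2_bounded_op_def
  proof (intro conjI ballI allI)
    show "\<exists>C. \<forall>x\<in>ell2. ell2_norm (?S x) \<le> C * ell2_norm x" using nS by blast
  qed (rule ell2_scale, simp_all add: fun_eq_iff algebra_simps)
  then have S: "ell2_inverse_op ?S (\<lambda>x n. band_op F (\<lambda>n. 0) x n - \<mu> * x n)"
    by (simp add: ell2_inverse_op_def band_op_def)
  have d: "ell2_norm (\<lambda>n. (band_op F (\<lambda>n. 0) x n - \<mu> * x n) - (band_op F c x n - \<mu> * x n))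
      \<le> (\<Sum>n\<in>F. cmod (c n)) * ell2_norm x" if "x \<in> ell2" for x
    using ell2_norm_band_op[OF F that, of "\<lambda>n. 0 - c n"]
    by (simp add: band_op_diff norm_minus_commute[of 0] del: diff_0)
  have "1 / cmod \<mu> * (\<Sum>n\<in>F. cmod (c n)) < 1"
    using gt by (simp add: field_simps)
  then have "\<exists>S'. ell2_inverse_op S' (\<lambda>x n. band_op F c x n - \<mu> * x n)"
    by (intro inverse_op_perturbation[OF bounded_op_band_op_minus_scalar[OF F]
          bounded_op_band_op_minus_scalar[OF F] S nS _ d])
      (simp_all add: sum_nonneg)
  then show False using \<mu> not_in_ell2_spectrum_iff by blast
qed

text \<open>
  The operator norm is dominated by the \<open>\<ell>\<^sup>1\<close> norm of the coefficients, so openness of the set of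
  invertible operators can be expressed through \<open>\<mu>\<close> and the coefficients alone.
\<close>

lemma resolvent_band_op_open:
  assumes F: "finite F" and "\<mu> \<notin> ell2_spectrum (band_op F c)"
  obtains e where "e > 0"
    "\<And>\<mu>' c'. (\<Sum>n\<in>F. cmod (c n - c' n)) + cmod (\<mu> - \<mu>') < e \<Longrightarrow> \<mu>' \<notin> ell2_spectrum (band_op F c')"
proof -
  obtain S where S: "ell2_inverse_op S (\<lambda>x n. band_op F c x n - \<mu> * x n)"
    using assms(2) not_in_ell2_spectrum_iff by blast
  then have "ell2_bounded_op S" by (simp add: ell2_inverse_op_def)
  then obtain C where C: "C > 0" "\<And>x. x \<in> ell2 \<Longrightarrow> ell2_norm (S x) \<le> C * ell2_norm x"
    using bounded_op_bound by blast
  show thesis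
  proof (rule that[of "1 / C"])
    show "1 / C > 0" using C by simp
    fix \<mu>' c'
    let ?d = "(\<Sum>n\<in>F. cmod (c n - c' n)) + cmod (\<mu> - \<mu>')"
    assume lt: "?d < 1 / C"
    have d: "ell2_norm (\<lambda>n. (band_op F c x n - \<mu> * x n) - (band_op F c' x n - \<mu>' * x n))
        \<le> ?d * ell2_norm x" if "x \<in> ell2" for x
    proof -
      have "(\<lambda>n. (band_op F c x n - \<mu> * x n) - (band_op F c' x n - \<mu>' * x n)) =
          (\<lambda>n. band_op F (\<lambda>n. c n - c' n) x n - (\<mu> - \<mu>') * x n)"
        by (simp add: band_op_diff[symmetric] algebra_simps)
      then show ?thesis
        using ell2_norm_diff_le[OF ell2_band_op[OF F that, of "\<lambda>n. c n - c' n"]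
            ell2_scale[OF that, of "\<mu> - \<mu>'"]]
          ell2_norm_band_op[OF F that, of "\<lambda>n. c n - c' n"]
        by (simp add: ell2_norm_scale[OF that] distrib_right)
    qed
    have "0 \<le> ?d" by (simp add: sum_nonneg)
    moreover have "C * ?d < 1" using lt C(1) by (simp add: field_simps)
    ultimately have "\<exists>S'. ell2_inverse_op S' (\<lambda>x n. band_op F c' x n - \<mu>' * x n)"
      by (intro inverse_op_perturbation[OF bounded_op_band_op_minus_scalar[OF F]
          bounded_op_band_op_minus_scalar[OF F] S C(2) less_imp_le[OF C(1)] d])
    then show "\<mu>' \<notin> ell2_spectrum (band_op F c')"
      using not_in_ell2_spectrum_iff by blast
  qed
qed

lemma integral_cis_multiple:
  "((\<lambda>v. cis (of_int m * v)) has_integral (if m = 0 then of_real (2 * pi) else 0)) {0..2 * pi}"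
proof (cases "m = 0")
  case True
  then show ?thesis
    using has_integral_const_real[of "1::complex" 0 "2 * pi"] by (simp add: scaleR_conv_of_real)
next
  case False
  have "((\<lambda>v. cis (of_int m * v)) has_integral
      (cis (of_int m * (2 * pi)) / (\<i> * of_int m) - cis (of_int m * 0) / (\<i> * of_int m))) {0..2 * pi}"
  proof (rule fundamental_theorem_of_calculus)
    fix v :: real
    define w :: complex where "w = \<i> * of_int m"
    have "w \<noteq> 0" using False by (simp add: w_def)
    then have "((\<lambda>z. exp (w * z) / w) has_field_derivative exp (w * of_real v)) (at (of_real v))"
      by (auto intro!: derivative_eq_intros)
    from has_vector_derivative_real_field[OF this, of "{0..2 * pi}"]
    show "((\<lambda>v. cis (of_int m * v) / (\<i> * of_int m)) has_vector_derivative cis (of_int m * v))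
        (at v within {0..2 * pi})"
      by (simp add: cis_conv_exp w_def mult.assoc)
  qed simp
  moreover have "cis (of_int m * (2 * pi)) = 1"
    using cis_multiple_2pi[of "of_int m"] by (simp add: mult_ac)
  ultimately show ?thesis using False by simp
qed

lemma fourier_coeff_scaled_laurent:
  "fourier_coeff (scaled_symbol (laurent r s b) \<rho>) k =
     (if k \<in> {- int r..int s} then b k * of_real \<rho> powi k else 0)"
proof -
  let ?R = "{- int r..int s}"
  have expand: "scaled_symbol (laurent r s b) \<rho> (cis v) * cis (- (of_int k * v)) =
      (\<Sum>n\<in>?R. b n * of_real \<rho> powi n * cis (of_int (n - k) * v))" for v
  proof -
    have "cis (of_int (n - k) * v) = cis (of_int n * v) * cis (- (of_int k * v))" for n
      by (simp add: cis_mult algebra_simps)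
    then show ?thesis
      unfolding scaled_symbol_def laurent_def sum_distrib_right
      by (intro sum.cong refl) (simp add: power_int_mult_distrib cis_power_int mult_ac)
  qed
  have "((\<lambda>v. \<Sum>n\<in>?R. b n * of_real \<rho> powi n * cis (of_int (n - k) * v)) has_integral
      (\<Sum>n\<in>?R. b n * of_real \<rho> powi n * (if n - k = 0 then of_real (2 * pi) else 0))) {0..2 * pi}"
    by (intro has_integral_sum has_integral_mult_right integral_cis_multiple) simp
  also have "(\<Sum>n\<in>?R. b n * of_real \<rho> powi n * (if n - k = 0 then of_real (2 * pi) else 0)) =
      (\<Sum>n\<in>?R. if n = k then b k * of_real \<rho> powi k * of_real (2 * pi) else 0)"
    by (intro sum.cong) auto
  finally show ?thesis
    unfolding fourier_coeff_def expand by (simp add: integral_unique)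
qed

text \<open>
  The Fourier coefficients vanish outside \<open>{- int r..int s}\<close>, so each row of the matrix has only
  finitely many nonzero entries; the sum is regrouped by diagonals.
\<close>

lemma toeplitz_scaled_laurent:
  "toeplitz (scaled_symbol (laurent r s b) \<rho>) =
     band_op {- int r..int s} (\<lambda>n. b n * of_real \<rho> powi n)"
proof (intro ext)
  fix x j
  let ?R = "{- int r..int s}" and ?c = "\<lambda>n. b n * of_real \<rho> powi n"
  have "(\<lambda>k. if n = int j - int k then ?c n * x k else 0) sums (?c n * shift n x j)" for n
  proof (cases "n \<le> int j")
    case True
    then have "(n = int j - int k) = (k = nat (int j - n))" for k by auto
    then show ?thesis
      using sums_single[of "nat (int j - n)" "\<lambda>k. ?c n * x k"] True by (simp add: shift_def)
  next
    case False
    then have "(n = int j - int k) = False" for k by auto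
    then show ?thesis using False by (simp add: shift_def)
  qed
  then have "(\<lambda>k. \<Sum>n\<in>?R. if n = int j - int k then ?c n * x k else 0) sums band_op ?R ?c x j"
    unfolding band_op_def by (intro sums_sum)
  moreover have "(\<Sum>n\<in>?R. if n = int j - int k then ?c n * x k else 0) =
      fourier_coeff (scaled_symbol (laurent r s b) \<rho>) (int j - int k) * x k" for k
    unfolding fourier_coeff_scaled_laurent by (simp add: sum.delta)
  ultimately show "toeplitz (scaled_symbol (laurent r s b) \<rho>) x j = band_op ?R ?c x j"
    by (simp add: toeplitz_def sums_iff)
qed

text \<open>
  The tolerance for the coefficients and \<open>\<mu>\<close> together is shared out equally: continuity of
  \<open>\<rho> powi n\<close> at \<open>\<rho> > 0\<close> (where negative \<open>n\<close> need \<open>\<rho> \<noteq> 0\<close>) controls the coefficients.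
\<close>

lemma resolvent_toeplitz_open:
  assumes "0 < \<rho>" and "\<mu> \<notin> ell2_spectrum (toeplitz (scaled_symbol (laurent r s b) \<rho>))"
  shows "\<exists>\<delta>>0. \<forall>\<mu>' \<rho>'. dist \<mu>' \<mu> < \<delta> \<longrightarrow> dist \<rho>' \<rho> < \<delta> \<longrightarrow>
       \<mu>' \<notin> ell2_spectrum (toeplitz (scaled_symbol (laurent r s b) \<rho>'))"
proof -
  let ?R = "{- int r..int s}" and ?c = "\<lambda>\<rho>::real. \<lambda>n. b n * of_real \<rho> powi n"
  obtain e where e: "e > 0"
    "\<And>\<mu>' c'. (\<Sum>n\<in>?R. cmod (?c \<rho> n - c' n)) + cmod (\<mu> - \<mu>') < e \<Longrightarrow>
       \<mu>' \<notin> ell2_spectrum (band_op ?R c')"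
    by (rule resolvent_band_op_open[OF finite_atLeastAtMost_int
          assms(2)[unfolded toeplitz_scaled_laurent]]) blast
  have "((\<lambda>\<rho>'. \<Sum>n\<in>?R. cmod (?c \<rho> n - ?c \<rho>' n)) \<longlongrightarrow> (\<Sum>n\<in>?R. cmod (?c \<rho> n - ?c \<rho> n))) (nhds \<rho>)"
    using assms(1) by (intro tendsto_intros filterlim_ident) auto
  then have "\<forall>\<^sub>F \<rho>' in nhds \<rho>. (\<Sum>n\<in>?R. cmod (?c \<rho> n - ?c \<rho>' n)) < e / 2"
    using e(1) by (intro order_tendstoD(2)[where y = "\<Sum>n\<in>?R. cmod (?c \<rho> n - ?c \<rho> n)"]) auto
  then obtain \<delta> where \<delta>: "\<delta> > 0"
    "\<And>\<rho>'. dist \<rho>' \<rho> < \<delta> \<Longrightarrow> (\<Sum>n\<in>?R. cmod (?c \<rho> n - ?c \<rho>' n)) < e / 2"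
    unfolding eventually_nhds_metric by blast
  show ?thesis
  proof (intro exI[of _ "min \<delta> (e / 2)"] conjI allI impI)
    show "0 < min \<delta> (e / 2)" using e \<delta> by simp
    fix \<mu>' \<rho>' assume "dist \<mu>' \<mu> < min \<delta> (e / 2)" "dist \<rho>' \<rho> < min \<delta> (e / 2)"
    then show "\<mu>' \<notin> ell2_spectrum (toeplitz (scaled_symbol (laurent r s b) \<rho>'))"
      unfolding toeplitz_scaled_laurent using \<delta>(2)[of \<rho>']
      by (intro e(2)) (simp add: dist_norm norm_minus_commute)
  qed
qed

section \<open>Partitions\<close>

lemma granularity_le_iff:
  assumes "0 \<le> \<Delta>"
  shows "granularity xs \<le> \<Delta> \<longleftrightarrow> (\<forall>j. Suc j < length xs \<longrightarrow> xs ! Suc j - xs ! j \<le> \<Delta>)"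
proof -
  have "{xs ! Suc j - xs ! j | j. Suc j < length xs} =
      (\<lambda>j. xs ! Suc j - xs ! j) ` {j. Suc j < length xs}" by auto
  moreover have "finite {j. Suc j < length xs}"
    by (rule finite_subset[of _ "{..<length xs}"]) auto
  ultimately have "finite {xs ! Suc j - xs ! j | j. Suc j < length xs}" by simp
  then show ?thesis using assms unfolding granularity_def by auto
qed

lemma partition_subset:
  assumes "xs \<in> partitions \<alpha> \<beta> \<Delta>"
  shows "set xs \<subseteq> {\<alpha>..\<beta>}"
proof
  fix y assume "y \<in> set xs"
  then obtain j where j: "j < length xs" "y = xs ! j" by (auto simp: in_set_conv_nth)
  have "sorted xs" using assms by (simp add: partitions_def strict_sorted_iff)
  moreover have "\<alpha> = xs ! 0" "\<beta> = xs ! (length xs - 1)"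
    using assms by (auto simp: partitions_def hd_conv_nth last_conv_nth)
  ultimately show "y \<in> {\<alpha>..\<beta>}"
    using j by (auto intro!: sorted_nth_mono)
qed

text \<open>
  The largest partition point \<open>y\<close> not exceeding \<open>\<rho>\<close> works: the next one lies beyond \<open>\<rho>\<close> and at most
  \<open>\<Delta>\<close> beyond \<open>y\<close>, and if there is none then \<open>y = \<beta> = \<rho>\<close>.
\<close>

lemma partition_near_point:
  assumes xs: "xs \<in> partitions \<alpha> \<beta> \<Delta>" and \<rho>: "\<rho> \<in> {\<alpha>..\<beta>}" and \<Delta>: "0 \<le> \<Delta>"
  obtains y where "y \<in> set xs" "dist y \<rho> \<le> \<Delta>"
proof -
  have ne: "xs \<noteq> []" and 0: "\<alpha> = xs ! 0" and l: "\<beta> = xs ! (length xs - 1)"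
    using xs by (auto simp: partitions_def hd_conv_nth last_conv_nth)
  define J where "J = {j. j < length xs \<and> xs ! j \<le> \<rho>}"
  have J: "finite J" "J \<noteq> {}"
    using ne 0 \<rho> unfolding J_def by (auto intro!: exI[of _ 0])
  define j where "j = Max J"
  have j: "j < length xs" "xs ! j \<le> \<rho>"
    using Max_in[OF J] by (auto simp: j_def J_def)
  show thesis
  proof (cases "Suc j < length xs")
    case True
    then have "xs ! Suc j - xs ! j \<le> \<Delta>"
      using xs \<Delta> by (simp add: partitions_def granularity_le_iff)
    moreover have "\<not> xs ! Suc j \<le> \<rho>"
      using True Max_ge[OF J(1), of "Suc j"] by (auto simp: j_def[symmetric]) (auto simp: J_def)
    ultimately show thesis
      using j by (intro that[of "xs ! j"]) (auto simp: dist_real_def)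
  next
    case False
    then have "j = length xs - 1" using j by simp
    then show thesis
      using j l \<rho> \<Delta> by (intro that[of "xs ! j"]) auto
  qed
qed

text \<open>
  The supremum of the empty set of extended reals is \<open>-\<infinity>\<close>, so convergence to \<open>0\<close> needs a partition
  for every positive \<open>\<Delta>\<close>; equidistant points serve.
\<close>

lemma partitions_nonempty:
  assumes "\<alpha> \<le> \<beta>" "0 < \<Delta>"
  shows "partitions \<alpha> \<beta> \<Delta> \<noteq> {}"
proof (cases "\<alpha> = \<beta>")
  case True
  then have "[\<alpha>] \<in> partitions \<alpha> \<beta> \<Delta>"
    using assms by (simp add: partitions_def granularity_le_iff)
  then show ?thesis by blast
next
  case False
  obtain m where m: "\<beta> - \<alpha> < of_nat m * \<Delta>"
    using assms(2) ex_less_of_nat_mult by blast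
  then have m0: "m > 0" using assms by (cases m) auto
  define h where "h = (\<beta> - \<alpha>) / m"
  have h: "0 < h" "h \<le> \<Delta>" "of_nat m * h = \<beta> - \<alpha>"
    using m m0 assms False by (auto simp: h_def field_simps)
  define xs where "xs = map (\<lambda>i. \<alpha> + of_nat i * h) [0..<Suc m]"
  have "sorted_wrt (<) xs"
    unfolding xs_def sorted_wrt_map using h(1)
    by (intro sorted_wrt_mono_rel[OF _ sorted_wrt_upt]) auto
  moreover have "granularity xs \<le> \<Delta>"
    using assms h by (auto simp: granularity_le_iff xs_def algebra_simps simp del: upt_Suc)
  moreover have "hd xs = \<alpha>" "last xs = \<beta>" "xs \<noteq> []"
    using h(3) by (auto simp: xs_def hd_map simp del: upt_Suc) (simp add: xs_def)
  ultimately have "xs \<in> partitions \<alpha> \<beta> \<Delta>" by (simp add: partitions_def)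
  then show ?thesis by blast
qed

section \<open>Convergence\<close>

lemma hausdorff_dist_nonneg: "0 \<le> hausdorff_dist A B"
  unfolding hausdorff_dist_def by (rule Inf_greatest) auto

lemma hausdorff_dist_le_if_superset:
  assumes "0 \<le> \<epsilon>" "B \<subseteq> A" "A \<subseteq> closed_nbhd \<epsilon> B"
  shows "hausdorff_dist A B \<le> ereal \<epsilon>"
  unfolding hausdorff_dist_def
proof (intro Inf_lower imageI CollectI conjI assms)
  show "B \<subseteq> closed_nbhd \<epsilon> A" using assms by (force simp: closed_nbhd_def)
qed

text \<open>
  Each point of \<open>K\<close> escapes some \<open>sp \<rho>\<close>, and by \<open>loc\<close> a whole neighbourhood of it escapes \<open>sp \<rho>'\<close> for all
  \<open>\<rho>'\<close> near \<open>\<rho>\<close>. Finitely many of these neighbourhoods cover \<open>K\<close>, and the least of their radii is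
  the uniform one.
\<close>

lemma uniform_resolvent_radius:
  fixes sp :: "'b::metric_space \<Rightarrow> 'a::metric_space set"
  assumes K: "compact K" and disj: "K \<inter> (\<Inter>\<rho>\<in>I. sp \<rho>) = {}"
    and loc: "\<And>\<rho> \<mu>. \<rho> \<in> I \<Longrightarrow> \<mu> \<notin> sp \<rho> \<Longrightarrow>
      \<exists>\<delta>>0. \<forall>\<mu>' \<rho>'. dist \<mu>' \<mu> < \<delta> \<longrightarrow> dist \<rho>' \<rho> < \<delta> \<longrightarrow> \<mu>' \<notin> sp \<rho>'"
  obtains \<delta> where "\<delta> > 0"
    "\<And>\<mu>. \<mu> \<in> K \<Longrightarrow> \<exists>\<rho>\<in>I. \<forall>\<rho>'. dist \<rho>' \<rho> < \<delta> \<longrightarrow> \<mu> \<notin> sp \<rho>'"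
proof -
  have "\<exists>\<rho> \<delta>. \<rho> \<in> I \<and> \<delta> > 0 \<and> (\<forall>\<mu>' \<rho>'. dist \<mu>' \<mu> < \<delta> \<longrightarrow> dist \<rho>' \<rho> < \<delta> \<longrightarrow> \<mu>' \<notin> sp \<rho>')"
    if "\<mu> \<in> K" for \<mu>
    using that disj loc by blast
  then obtain \<rho> \<delta> where \<rho>: "\<And>\<mu>. \<mu> \<in> K \<Longrightarrow> \<rho> \<mu> \<in> I" and \<delta>: "\<And>\<mu>. \<mu> \<in> K \<Longrightarrow> \<delta> \<mu> > 0"
    "\<And>\<mu> \<mu>' \<rho>'. \<mu> \<in> K \<Longrightarrow> dist \<mu>' \<mu> < \<delta> \<mu> \<Longrightarrow> dist \<rho>' (\<rho> \<mu>) < \<delta> \<mu> \<Longrightarrow> \<mu>' \<notin> sp \<rho>'"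
    by metis
  have cover: "K \<subseteq> (\<Union>\<mu>\<in>K. ball \<mu> (\<delta> \<mu>))"
    using \<delta>(1) by auto
  obtain C where C: "C \<subseteq> K" "finite C" "K \<subseteq> (\<Union>\<mu>\<in>C. ball \<mu> (\<delta> \<mu>))"
    using compactE_image[OF K _ cover] by auto
  \<comment> \<open>Inserting \<open>1\<close> keeps the minimum meaningful when \<open>K\<close>, and with it \<open>C\<close>, is empty.\<close>
  let ?d = "Min (insert 1 (\<delta> ` C))"
  show thesis
  proof (rule that[of ?d])
    show "?d > 0" using C \<delta>(1) by auto
    fix \<mu> assume "\<mu> \<in> K"
    then obtain \<mu>0 where \<mu>0: "\<mu>0 \<in> C" "dist \<mu> \<mu>0 < \<delta> \<mu>0"
      using C(3) by (auto simp: dist_commute)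
    have "?d \<le> \<delta> \<mu>0" using C(2) \<mu>0(1) by (intro Min_le) auto
    then show "\<exists>\<rho>\<in>I. \<forall>\<rho>'. dist \<rho>' \<rho> < ?d \<longrightarrow> \<mu> \<notin> sp \<rho>'"
      using \<mu>0 C(1) \<rho> \<delta>(2) by (meson less_le_trans subsetD)
  qed
qed

theorem theorem2p4:
  fixes r s :: nat and b :: "int \<Rightarrow> complex" and \<rho>l \<rho>h :: real
  assumes "r > 0" and "s > 0"
    and "b (- int r) \<noteq> 0" and "b (int s) \<noteq> 0"
    and "0 < \<rho>l" and "\<rho>l \<le> \<rho>h"
    and "limit_set r s b =
           (\<Inter>\<rho>\<in>{\<rho>l..\<rho>h}. ell2_spectrum (toeplitz (scaled_symbol (laurent r s b) \<rho>)))"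
  shows "((\<lambda>\<Delta>. SUP \<rho>s\<in>partitions \<rho>l \<rho>h \<Delta>.
             hausdorff_dist
               (\<Inter>\<rho>\<in>set \<rho>s. ell2_spectrum (toeplitz (scaled_symbol (laurent r s b) \<rho>)))
               (limit_set r s b)) \<longlongrightarrow> 0) (at_right 0)"
proof -
  define sp where "sp \<rho> = ell2_spectrum (toeplitz (scaled_symbol (laurent r s b) \<rho>))" for \<rho>
  define L where "L = limit_set r s b"
  have L: "L = (\<Inter>\<rho>\<in>{\<rho>l..\<rho>h}. sp \<rho>)" using assms(7) by (simp add: L_def sp_def)
  let ?d = "\<lambda>\<rho>s. hausdorff_dist (\<Inter>\<rho>\<in>set \<rho>s. sp \<rho>) L"
  obtain M where M: "\<And>\<mu>. \<mu> \<in> sp \<rho>l \<Longrightarrow> cmod \<mu> \<le> M"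
    unfolding sp_def toeplitz_scaled_laurent
    using spectrum_band_op_bounded[OF finite_atLeastAtMost_int] by blast
  have loc: "\<exists>\<delta>>0. \<forall>\<mu>' \<rho>'. dist \<mu>' \<mu> < \<delta> \<longrightarrow> dist \<rho>' \<rho> < \<delta> \<longrightarrow> \<mu>' \<notin> sp \<rho>'"
    if "\<rho> \<in> {\<rho>l..\<rho>h}" "\<mu> \<notin> sp \<rho>" for \<rho> \<mu>
    using that \<open>0 < \<rho>l\<close> unfolding sp_def by (intro resolvent_toeplitz_open) auto
  have upper: "\<forall>\<^sub>F \<Delta> in at_right 0. (SUP \<rho>s\<in>partitions \<rho>l \<rho>h \<Delta>. ?d \<rho>s) \<le> ereal \<epsilon>"
    if "\<epsilon> > 0" for \<epsilon>
  proof -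
    define K where "K = cball 0 M - (\<Union>x\<in>L. ball x \<epsilon>)"
    have K: "compact K" unfolding K_def by (intro compact_diff compact_cball open_UN ballI open_ball)
    have disj: "K \<inter> (\<Inter>\<rho>\<in>{\<rho>l..\<rho>h}. sp \<rho>) = {}"
      unfolding K_def L[symmetric] using \<open>\<epsilon> > 0\<close> by auto
    obtain \<delta> where \<delta>: "\<delta> > 0"
      "\<And>\<mu>. \<mu> \<in> K \<Longrightarrow> \<exists>\<rho>\<in>{\<rho>l..\<rho>h}. \<forall>\<rho>'. dist \<rho>' \<rho> < \<delta> \<longrightarrow> \<mu> \<notin> sp \<rho>'"
      by (rule uniform_resolvent_radius[OF K disj loc]) blast+
    have "?d \<rho>s \<le> ereal \<epsilon>" if \<Delta>: "0 < \<Delta>" "\<Delta> < \<delta>" and \<rho>s: "\<rho>s \<in> partitions \<rho>l \<rho>h \<Delta>" for \<Delta> \<rho>s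
    proof (rule hausdorff_dist_le_if_superset)
      show "0 \<le> \<epsilon>" using \<open>\<epsilon> > 0\<close> by simp
      show "L \<subseteq> (\<Inter>\<rho>\<in>set \<rho>s. sp \<rho>)"
        unfolding L using partition_subset[OF \<rho>s] by blast
      show "(\<Inter>\<rho>\<in>set \<rho>s. sp \<rho>) \<subseteq> closed_nbhd \<epsilon> L"
      proof
        fix \<mu> assume \<mu>: "\<mu> \<in> (\<Inter>\<rho>\<in>set \<rho>s. sp \<rho>)"
        have "\<rho>l \<in> set \<rho>s"
          using \<rho>s by (auto simp: partitions_def)
        then have "\<mu> \<in> cball 0 M" using \<mu> M by auto
        moreover have "\<mu> \<notin> K"
        proof
          assume "\<mu> \<in> K"
          then obtain \<rho> where \<rho>: "\<rho> \<in> {\<rho>l..\<rho>h}" "\<And>\<rho>'. dist \<rho>' \<rho> < \<delta> \<Longrightarrow> \<mu> \<notin> sp \<rho>'"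
            using \<delta>(2) by blast
          obtain y where "y \<in> set \<rho>s" "dist y \<rho> \<le> \<Delta>"
            using partition_near_point[OF \<rho>s \<rho>(1)] \<Delta>(1) by auto
          then show False using \<rho>(2)[of y] \<mu> \<Delta>(2) by auto
        qed
        ultimately show "\<mu> \<in> closed_nbhd \<epsilon> L"
          unfolding K_def closed_nbhd_def by (fastforce intro: less_imp_le)
      qed
    qed
    then show ?thesis
      unfolding eventually_at_right_field using \<delta>(1) by (intro exI[of _ \<delta>]) (auto intro!: SUP_least)
  qed
  have lower: "\<forall>\<^sub>F \<Delta> in at_right 0. 0 \<le> (SUP \<rho>s\<in>partitions \<rho>l \<rho>h \<Delta>. ?d \<rho>s)"
    unfolding eventually_at_right_field
  proof (intro exI[of _ 1] conjI allI impI)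
    fix \<Delta> :: real assume "0 < \<Delta>"
    then obtain \<rho>s where "\<rho>s \<in> partitions \<rho>l \<rho>h \<Delta>"
      using partitions_nonempty[OF \<open>\<rho>l \<le> \<rho>h\<close>] by blast
    then show "0 \<le> (SUP \<rho>s\<in>partitions \<rho>l \<rho>h \<Delta>. ?d \<rho>s)"
      by (intro SUP_upper2[of \<rho>s] hausdorff_dist_nonneg)
  qed simp
  have "((\<lambda>\<Delta>. SUP \<rho>s\<in>partitions \<rho>l \<rho>h \<Delta>. ?d \<rho>s) \<longlongrightarrow> 0) (at_right 0)"
  proof (rule order_tendstoI)
    fix a :: ereal assume "a < 0"
    then show "\<forall>\<^sub>F \<Delta> in at_right 0. a < (SUP \<rho>s\<in>partitions \<rho>l \<rho>h \<Delta>. ?d \<rho>s)"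
      by (intro eventually_mono[OF lower]) (rule less_le_trans)
  next
    fix a :: ereal assume "0 < a"
    then obtain \<epsilon> where "0 < ereal \<epsilon>" "ereal \<epsilon> < a"
      using ereal_dense2 by blast
    then show "\<forall>\<^sub>F \<Delta> in at_right 0. (SUP \<rho>s\<in>partitions \<rho>l \<rho>h \<Delta>. ?d \<rho>s) < a"
      using upper[of \<epsilon>] by (auto elim!: eventually_mono)
  qed
  then show ?thesis unfolding sp_def L_def .
qed

end
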